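(* Consider a continuous-price one-side order book with homogeneous Poisson arrival of unit-size market orders with intensity $\mu$, spatial Poisson arrival of limit orders with intensity $\lambda(p,t)=\alpha h_\lambda(p)$ (price $p\ge0$, time $t\ge0$), geometric distribution of the sizes of limit orders with parameter $q\in(0,1)$ (size $n\ge1$ with probability $(1-q)^{n-1}q$, independently of the price), and exponentially distributed lifetimes of non-executed limit orders with parameter $\theta>0$ (cancellation being share by share). Put $\delta=\mu/\theta$, $h(p)=\alpha h_\lambda(p)/\theta$ and $H(p)=\int_0^p h(u)\,du$. Let $B(p)=\mathbf E[L([0,p])]$ be the average cumulative shape of the order book up to price $p$ and $b(p)=\frac{dB(p)}{dp}$ the average shape of the order book. Then for all $p\in[0,\infty)$, $$b(p)=\frac{h(p)}{q}+\frac{d}{dp}\left(\frac{\delta\,q^{\frac{H(p)}{1-q}}}{{}_2F_1\!\left(\delta,\frac{-H(p)}{1-q},1+\delta,1-q\right)}\right),$$ where ${}_2F_1(a,b,c,z)=\sum_{n\ge0}\frac{(a)_n(b)_n}{(c)_n}\frac{z^n}{n!}$ is the ordinary hypergeometric function.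
   Context: One-side order book model: all limit orders are sell (ask) orders and all market orders are buy orders. Prices are non-negative reals. The function $h_\lambda$ is a real non-negative function with positive support (the spatial intensity of arrivals of limit orders) and $\alpha$ is a constant. Limit orders are the points of a Poisson process on (price, time) space $\mathbb R_+^2$ with intensity $\alpha h_\lambda(p)$; thus limit orders with price in $[p_1,p_2]$ arrive according to a homogeneous Poisson process of rate $\alpha\int_{p_1}^{p_2}h_\lambda(u)\,du$. The sizes (numbers of shares) of limit orders are independent geometric random variables as stated. Market orders have unit size and arrive according to an independent Poisson process of rate $\mu$; each market order removes one standing share at the lowest available price, if any. Cancellation is share by share: each standing share not yet executed is cancelled after an independent exponential time of parameter $\theta$ from the submission of its order. $L([0,p])$ denotes the total number of shares with price in $[0,p]$ standing in the book. As a process in time it is a continuous-time Markov chain on $\{0,1,2,\dots\}$ (the size of an $M^X/M/1+M$ queue) with transition rates: $m\to m+n$ at rate $\theta H(p)(1-q)^{n-1}q$ for $m\ge0$, $n\ge1$; $m\to m-1$ at rate $\mu+m\theta$ for $m\ge1$; no other transitions. $\mathbf E[L([0,p])]$ is its mean under its stationary distribution. $(a)_n=a(a+1)\cdots(a+n-1)$, $(a)_0=1$, is the rising Pochhammer symbol.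
   Formalization: The formula is asserted at each p≥0 where H is differentiable with H'(p)=h(p) (every p if h_λ is continuous; one-sided at 0), since it fails where h_λ is altered at a single point; h_λ is assumed integrable on each [0,p] so that H is finite. *)

theory Defs
  imports "HOL-Probability.Probability"
begin

definition hypergeo_2F1 :: "real \<Rightarrow> real \<Rightarrow> real \<Rightarrow> real \<Rightarrow> real" where
  "hypergeo_2F1 a b c z =
     (\<Sum>n. pochhammer a n * pochhammer b n / pochhammer c n * (z ^ n / fact n))"

(* Stationary distribution of a continuous-time Markov chain with jump rates r i j (i \<noteq> j):
   pi Q = 0, i.e. the probability flow into each state j equals the flow out of j.
   The diagonal values r j j are never used. *)
definition stationary_distribution :: "('s \<Rightarrow> 's \<Rightarrow> real) \<Rightarrow> 's pmf \<Rightarrow> bool" where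
  "stationary_distribution r \<pi> \<longleftrightarrow>
     (\<forall>j. ((\<lambda>i. pmf \<pi> i * r i j) has_sum (pmf \<pi> j * (\<Sum>\<^sub>\<infinity>k\<in>-{j}. r j k))) (-{j}))"

(* Jump rate m \<rightarrow> k of the number of standing shares, when limit orders arrive at total rate
   \<Lambda>: batches of n = k - m shares with geometric size on {1, 2, ...}; single departures by
   execution (rate \<mu>) or cancellation of one of the m shares (rate \<theta> each). *)
definition book_size_rate :: "real \<Rightarrow> real \<Rightarrow> real \<Rightarrow> real \<Rightarrow> nat \<Rightarrow> nat \<Rightarrow> real" where
  "book_size_rate \<Lambda> q \<mu> \<theta> m k =
     (if m < k then \<Lambda> * ((1 - q) ^ (k - m - 1) * q)
      else if m = k + 1 then \<mu> + real m * \<theta>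
      else 0)"

definition limit_order_rate :: "real \<Rightarrow> (real \<Rightarrow> real) \<Rightarrow> real \<Rightarrow> real" where
  "limit_order_rate \<alpha> h_lam p = \<alpha> * integral {0..p} h_lam"

(* Jump rates of L([0,p]): market orders hit the lowest prices first, so orders above p
   do not influence the shares standing in [0,p]. *)
definition L_rate ::
  "real \<Rightarrow> (real \<Rightarrow> real) \<Rightarrow> real \<Rightarrow> real \<Rightarrow> real \<Rightarrow> real \<Rightarrow> nat \<Rightarrow> nat \<Rightarrow> real" where
  "L_rate \<alpha> h_lam q \<mu> \<theta> p = book_size_rate (limit_order_rate \<alpha> h_lam p) q \<mu> \<theta>"

definition L_law ::
  "real \<Rightarrow> (real \<Rightarrow> real) \<Rightarrow> real \<Rightarrow> real \<Rightarrow> real \<Rightarrow> real \<Rightarrow> nat pmf" where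
  "L_law \<alpha> h_lam q \<mu> \<theta> p = (THE \<pi>. stationary_distribution (L_rate \<alpha> h_lam q \<mu> \<theta> p) \<pi>)"

definition average_cumulative_shape ::
  "real \<Rightarrow> (real \<Rightarrow> real) \<Rightarrow> real \<Rightarrow> real \<Rightarrow> real \<Rightarrow> real \<Rightarrow> real" where
  "average_cumulative_shape \<alpha> h_lam q \<mu> \<theta> p = measure_pmf.expectation (L_law \<alpha> h_lam q \<mu> \<theta> p) real"

(* d/dp on the price domain [0,\<infinity>): one-sided at p = 0, the usual derivative for p > 0. *)
definition price_deriv :: "(real \<Rightarrow> real) \<Rightarrow> real \<Rightarrow> real" where
  "price_deriv f p = vector_derivative f (at p within {0..})"

(* Where the intensity is continuous, the cumulative intensity has it as derivative. *)
lemma cumulative_has_real_derivative: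
  fixes h :: "real \<Rightarrow> real"
  assumes int: "\<And>x. h integrable_on {0..x}" and p: "0 \<le> p"
    and cont: "continuous (at p within {0..}) h"
  shows "((\<lambda>x. integral {0..x} h) has_real_derivative h p) (at p within {0..})"
proof -
  have "continuous (at p within {0..p + 1}) h"
    using cont by (rule continuous_within_subset) auto
  then have "((\<lambda>x. integral {0..x} h) has_vector_derivative h p) (at p within {0..p + 1})"
    using integral_has_vector_derivative_continuous_at[OF int, of p "p + 1" "{}"] p by simp
  moreover have "at p within {0..} = at p within {0..p + 1}"
    by (rule at_within_nhd[where S = "{..<p + 1}"]) auto
  ultimately show ?thesis
    by (simp add: has_real_derivative_iff_has_vector_derivative)
qed

end

theory Submission
  imports Defs
begin

text \<open>Put \<open>s = 1 - q\<close>, \<open>\<eta> = H p\<close>, \<open>a = \<eta> / s\<close>, and write \<open>S n\<close> for the sum of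
  \<open>\<pi> k s\<^bsup>n-1-k\<^esup>\<close> over \<open>k < n\<close>. Summing the balance equations gives the cut equations
  \<open>(\<delta> + n) \<pi> n = \<eta> S n\<close>, whose solutions are the multiples of an explicit weight; its total mass
  is \<open>q C\<close> and its first moment \<open>\<eta> C - \<delta> (q C - 1)\<close>, where \<open>C\<close> is the sum of
  \<open>(1+\<delta>+a)\<^sub>n / (1+\<delta>)\<^sub>n s\<^sup>n\<close>. Hence the mean is \<open>\<eta> / q - \<delta> + \<delta> / (q C)\<close>, and Euler's
  transformation rewrites \<open>q C\<close> as \<open>q powr (-a)\<close> times the hypergeometric function.
  It remains to differentiate in \<open>p\<close>, for which \<open>C\<close> is differentiated termwise in \<open>a\<close>.\<close>

section \<open>Power series with coefficients \<open>(d + a)_n / (d)_n\<close>\<close>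

text \<open>The operator x d/dx multiplies the n-th coefficient by n without shifting the index.
  Giving the series of \<open>x * D\<close> rather than of \<open>D\<close> lets a coefficient
  recurrence be read as a differential equation.\<close>

lemma power_series_deriv_sums:
  fixes c :: "nat \<Rightarrow> real"
  assumes summable: "\<And>x. norm x < 1 \<Longrightarrow> summable (\<lambda>n. c n * x ^ n)" and x: "norm x < 1"
  obtains D where "((\<lambda>x. \<Sum>n. c n * x ^ n) has_real_derivative D) (at x)"
    "(\<lambda>n. real n * c n * x ^ n) sums (x * D)"
proof
  show "((\<lambda>x. \<Sum>n. c n * x ^ n) has_real_derivative (\<Sum>n. diffs c n * x ^ n)) (at x)"
    using summable x by (rule termdiffs_strong')
  have "(\<lambda>n. diffs c n * x ^ n) sums (\<Sum>n. diffs c n * x ^ n)"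
    using termdiff_converges[OF x summable] by (rule summable_sums)
  from sums_mult[OF this, of x]
  have "(\<lambda>n. real (Suc n) * c (Suc n) * x ^ Suc n) sums (x * (\<Sum>n. diffs c n * x ^ n))"
    by (simp add: diffs_def mult_ac)
  then show "(\<lambda>n. real n * c n * x ^ n) sums (x * (\<Sum>n. diffs c n * x ^ n))"
    by (subst (asm) sums_Suc_iff) simp
qed

text \<open>The power series with these coefficients is 2F1(d + a, 1; d; x), since (1)_n cancels
  n!.\<close>

definition poch_ratio :: "real \<Rightarrow> real \<Rightarrow> nat \<Rightarrow> real" where
  "poch_ratio a d n = pochhammer (d + a) n / pochhammer d n"

lemma poch_ratio_0 [simp]: "poch_ratio a d 0 = 1"
  by (simp add: poch_ratio_def)

lemma poch_ratio_Suc: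
  assumes "d > 0"
  shows "poch_ratio a d (Suc n) = poch_ratio a d n * (d + a + real n) / (d + real n)"
  by (simp add: poch_ratio_def pochhammer_Suc)

lemma poch_ratio_pos:
  assumes "d > 0" "a \<ge> 0"
  shows "poch_ratio a d n > 0"
  using assms by (simp add: poch_ratio_def pochhammer_pos)

text \<open>Consecutive terms have ratio (d + a + n) / (d + n) * |x| in modulus, which tends to |x|.
  The midpoint of |x| and 1 serves as ratio-test constant; \<open>N\<close> makes a at most n (1 -
  |x|) / 2 from there on.\<close>

lemma summable_poch_ratio:
  assumes d: "d > 0" and a: "a \<ge> 0" and x: "norm x < 1"
  shows "summable (\<lambda>n. poch_ratio a d n * x ^ n)"
proof -
  obtain N :: nat where N: "2 * a / (1 - \<bar>x\<bar>) \<le> real N"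
    using real_arch_simple by blast
  show ?thesis
  proof (rule summable_ratio_test)
    show "(1 + \<bar>x\<bar>) / 2 < 1" using x by simp
  next
    fix n assume "n \<ge> N"
    then have "2 * a / (1 - \<bar>x\<bar>) \<le> real n" using N by linarith
    then have *: "2 * a \<le> real n * (1 - \<bar>x\<bar>)" using x by (simp add: field_simps)
    have "\<bar>x\<bar> * a \<le> a" using a x by (intro mult_left_le_one_le) auto
    moreover have "(d + real n) * (1 - \<bar>x\<bar>) \<ge> real n * (1 - \<bar>x\<bar>)"
      using d x by (intro mult_right_mono) auto
    ultimately have "\<bar>x\<bar> * a * 2 \<le> (d + real n) * (1 - \<bar>x\<bar>)" using * by linarith
    then have "(d + a + real n) * \<bar>x\<bar> \<le> (1 + \<bar>x\<bar>) / 2 * (d + real n)"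
      by (simp add: algebra_simps)
    then have r: "(d + a + real n) / (d + real n) * \<bar>x\<bar> \<le> (1 + \<bar>x\<bar>) / 2"
      using d by (simp add: divide_simps add_pos_nonneg)
    have "norm (poch_ratio a d (Suc n) * x ^ Suc n) =
        ((d + a + real n) / (d + real n) * \<bar>x\<bar>) * norm (poch_ratio a d n * x ^ n)"
      using d a poch_ratio_pos[OF d a] by (simp add: poch_ratio_Suc abs_mult power_abs)
    also have "\<dots> \<le> (1 + \<bar>x\<bar>) / 2 * norm (poch_ratio a d n * x ^ n)"
      using r by (intro mult_right_mono) auto
    finally show "norm (poch_ratio a d (Suc n) * x ^ Suc n) \<le>
      (1 + \<bar>x\<bar>) / 2 * norm (poch_ratio a d n * x ^ n)" .
  qed
qed

text \<open>Multiply the recurrence (n + d) c_(n+1) = (n + d + a) c_n by x^(n+1) and sum: both sides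
  become combinations of the series and \<open>x * D\<close>.\<close>

lemma poch_ratio_series_ode:
  assumes d: "d > 0" and a: "a \<ge> 0" and x: "norm x < 1"
  obtains D where
    "((\<lambda>x. \<Sum>n. poch_ratio a d n * x ^ n) has_real_derivative D) (at x)"
    "x * (1 - x) * D = (d - 1) + (x * (d + a) - (d - 1)) * (\<Sum>n. poch_ratio a d n * x ^ n)"
proof -
  define C where "C = (\<Sum>n. poch_ratio a d n * x ^ n)"
  obtain D where
    D: "((\<lambda>x. \<Sum>n. poch_ratio a d n * x ^ n) has_real_derivative D) (at x)" and
    T: "(\<lambda>n. real n * poch_ratio a d n * x ^ n) sums (x * D)"
    using power_series_deriv_sums[OF summable_poch_ratio[OF d a] x] by blast
  have S: "(\<lambda>n. poch_ratio a d n * x ^ n) sums C"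
    unfolding C_def by (rule summable_sums[OF summable_poch_ratio[OF d a x]])
  have "(\<lambda>n. real n * poch_ratio a d n * x ^ n + (d - 1) * (poch_ratio a d n * x ^ n))
      sums (x * D + (d - 1) * C)"
    by (intro sums_add sums_mult T S)
  \<comment> \<open>The dropped term of index 0 is d - 1, and the shift turns the factor n + d - 1
    into n + d.\<close>
  then have L: "(\<lambda>n. (real n + d) * poch_ratio a d (Suc n) * x ^ Suc n)
      sums (x * D + (d - 1) * C - (d - 1))"
    using sums_Suc_iff[of "\<lambda>n. real n * poch_ratio a d n * x ^ n + (d - 1) * (poch_ratio a d n * x ^ n)"
      "x * D + (d - 1) * C - (d - 1)"] by (simp add: algebra_simps)
  have "(\<lambda>n. x * ((d + a) * (poch_ratio a d n * x ^ n) + real n * poch_ratio a d n * x ^ n))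
      sums (x * ((d + a) * C + x * D))"
    by (intro sums_add sums_mult T S)
  also have "(\<lambda>n. x * ((d + a) * (poch_ratio a d n * x ^ n) + real n * poch_ratio a d n * x ^ n))
      = (\<lambda>n. (real n + d) * poch_ratio a d (Suc n) * x ^ Suc n)"
  proof
    fix n :: nat
    have "d + real n \<noteq> 0" using d by linarith
    then have "(real n + d) * poch_ratio a d (Suc n) = (d + a + real n) * poch_ratio a d n"
      using d by (simp add: poch_ratio_Suc field_simps)
    then show "x * ((d + a) * (poch_ratio a d n * x ^ n) + real n * poch_ratio a d n * x ^ n) =
        (real n + d) * poch_ratio a d (Suc n) * x ^ Suc n"
      by (simp add: algebra_simps)
  qed
  finally have "x * ((d + a) * C + x * D) = x * D + (d - 1) * C - (d - 1)"
    using L sums_unique2 by blast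
  then have "x * (1 - x) * D = (d - 1) + (x * (d + a) - (d - 1)) * C"
    by (simp add: algebra_simps)
  with D show ?thesis unfolding C_def by (rule that)
qed

section \<open>The hypergeometric function and Euler's transformation\<close>

text \<open>The \<open>g n\<close> are the Taylor coefficients of (1 - x)^a, and
  \<open>(d)_n / (1 + d)_n\<close> is d / (d + n) when d + n > 0. Hence x d/dx + d cancels the
  denominators and leaves d times the binomial series.\<close>

lemma hypergeo_ode:
  fixes d a x :: real
  assumes d: "d \<ge> 0" and x: "norm x < 1"
  obtains D where
    "(hypergeo_2F1 d (- a) (1 + d) has_real_derivative D) (at x)"
    "x * D + d * hypergeo_2F1 d (- a) (1 + d) x = d * (1 - x) powr a"
proof -
  define g where "g n = pochhammer (- a) n / fact n" for n :: nat
  define e where "e n = pochhammer d n / pochhammer (1 + d) n * g n" for n :: nat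
  have hyp: "hypergeo_2F1 d (- a) (1 + d) = (\<lambda>z. \<Sum>n. e n * z ^ n)"
    by (simp add: hypergeo_2F1_def e_def g_def fun_eq_iff mult_ac)
  have g: "(\<lambda>n. g n * z ^ n) sums (1 - z) powr a" if "norm z < 1" for z :: real
  proof -
    have "(\<lambda>n. (a gchoose n) * (- z) ^ n) sums (1 + - z) powr a"
      using that by (intro gen_binomial_real) simp
    moreover have "(a gchoose n) * (- z) ^ n = g n * z ^ n" for n
    proof -
      have "(- 1) ^ n * (- z) ^ n = z ^ n" by (simp flip: power_mult_distrib)
      then show ?thesis by (simp add: gbinomial_pochhammer g_def)
    qed
    ultimately show ?thesis by simp
  qed
  \<comment> \<open>The multipliers lie in [0, 1], so convergence is inherited from the binomial
    series, whose absolute convergence at \<open>z\<close> follows from convergence at (1 + |z|) /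
    2.\<close>
  have le: "norm (pochhammer d n / pochhammer (1 + d) n) \<le> 1" for n
  proof -
    have "0 \<le> pochhammer d n" "0 < pochhammer (1 + d) n" "pochhammer d n \<le> pochhammer (1 + d) n"
      using d by (auto simp: pochhammer_prod intro!: prod_nonneg prod_pos prod_mono)
    then show ?thesis by (simp add: divide_simps)
  qed
  have summable: "summable (\<lambda>n. e n * z ^ n)" if z: "norm z < 1" for z :: real
  proof (rule summable_comparison_test')
    have "summable (\<lambda>n. g n * ((1 + \<bar>z\<bar>) / 2) ^ n)"
      using g[of "(1 + \<bar>z\<bar>) / 2"] z by (auto intro: sums_summable)
    then show "summable (\<lambda>n. norm (g n * z ^ n))"
      by (rule powser_insidea) (use z in simp)
    fix n
    have "norm (e n * z ^ n) = norm (pochhammer d n / pochhammer (1 + d) n) * norm (g n * z ^ n)"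
      by (simp add: e_def norm_mult abs_mult divide_simps)
    also have "\<dots> \<le> norm (g n * z ^ n)"
      using le by (intro mult_left_le_one_le) auto
    finally show "norm (e n * z ^ n) \<le> norm (g n * z ^ n)" .
  qed
  \<comment> \<open>Only n = d = 0 makes n + d vanish, and then both sides are 0. Otherwise
    (d)_(n+1) is expanded from either end.\<close>
  have e: "(real n + d) * e n = d * g n" for n
  proof (cases "real n + d = 0")
    case True
    then have "d = 0" using d by linarith
    with True show ?thesis by simp
  next
    case False
    have "pochhammer d n * (real n + d) = d * pochhammer (1 + d) n"
      using pochhammer_rec[of d n] pochhammer_Suc[of d n] by (simp add: add_ac)
    moreover have "pochhammer (1 + d) n > 0" using d by (intro pochhammer_pos) simp
    ultimately show ?thesis by (simp add: e_def field_simps)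
  qed
  obtain D where D: "((\<lambda>x. \<Sum>n. e n * x ^ n) has_real_derivative D) (at x)"
    and T: "(\<lambda>n. real n * e n * x ^ n) sums (x * D)"
    using power_series_deriv_sums[OF summable x] by blast
  have "(\<lambda>n. real n * e n * x ^ n + d * (e n * x ^ n)) sums (x * D + d * (\<Sum>n. e n * x ^ n))"
    by (intro sums_add sums_mult T summable_sums[OF summable[OF x]])
  moreover have "(\<lambda>n. real n * e n * x ^ n + d * (e n * x ^ n)) = (\<lambda>n. d * (g n * x ^ n))"
  proof
    fix n
    have "real n * e n * x ^ n + d * (e n * x ^ n) = ((real n + d) * e n) * x ^ n"
      by (simp add: algebra_simps)
    then show "real n * e n * x ^ n + d * (e n * x ^ n) = d * (g n * x ^ n)"
      by (simp add: e)
  qed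
  moreover have "(\<lambda>n. d * (g n * x ^ n)) sums (d * (1 - x) powr a)"
    by (intro sums_mult g x)
  ultimately have "x * D + d * (\<Sum>n. e n * x ^ n) = d * (1 - x) powr a"
    by (metis sums_unique2)
  with D show ?thesis by (rule that[unfolded hyp])
qed

lemma hypergeo_2F1_0 [simp]: "hypergeo_2F1 a b c 0 = 1"
  using powser_zero[of "\<lambda>n. pochhammer a n * pochhammer b n / pochhammer c n / fact n"]
  by (simp add: hypergeo_2F1_def)

text \<open>Both sides solve \<open>x u' + d u = d (1 - x)\<^sup>a\<close> and take the value 1 at the origin, so \<open>x\<^sup>d\<close>
  times their difference is constant.\<close>

lemma hypergeo_Euler:
  assumes d: "d \<ge> 0" and a: "a \<ge> 0" and x: "0 \<le> x" "x < 1"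
  shows "hypergeo_2F1 d (- a) (1 + d) x =
    (1 - x) powr (1 + a) * (\<Sum>n. poch_ratio a (1 + d) n * x ^ n)"
proof (cases "x = 0")
  case True
  then show ?thesis by simp
next
  case False
  define u where "u z = hypergeo_2F1 d (- a) (1 + d) z -
    (1 - z) powr (1 + a) * (\<Sum>n. poch_ratio a (1 + d) n * z ^ n)" for z
  have u0: "u 0 = 0" by (simp add: u_def)
  have u: "\<exists>D. (u has_real_derivative D) (at z) \<and> z * D + d * u z = 0"
    if z: "0 \<le> z" "z < 1" for z
  proof -
    define C where "C = (\<Sum>n. poch_ratio a (1 + d) n * z ^ n)"
    have z': "norm z < 1" using z by simp
    obtain D1 where D1: "(hypergeo_2F1 d (- a) (1 + d) has_real_derivative D1) (at z)"
      "z * D1 + d * hypergeo_2F1 d (- a) (1 + d) z = d * (1 - z) powr a"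
      using hypergeo_ode[OF d z'] by blast
    obtain D2 where
      D2: "((\<lambda>x. \<Sum>n. poch_ratio a (1 + d) n * x ^ n) has_real_derivative D2) (at z)" and
      ode: "z * (1 - z) * D2 = d + (z * (1 + d + a) - d) * C"
      using poch_ratio_series_ode[of "1 + d" a z] d a z' by (auto simp: C_def)
    have P: "((\<lambda>z. (1 - z) powr (1 + a)) has_real_derivative - (1 + a) * (1 - z) powr a) (at z)"
      using z by (auto intro!: derivative_eq_intros simp: algebra_simps)
    have eq: "(1 - z) powr (1 + a) = (1 - z) powr a * (1 - z)"
      using z by (simp add: powr_add)
    define D where "D = D1 - (- (1 + a) * (1 - z) powr a * C + D2 * (1 - z) powr (1 + a))"
    have "(u has_real_derivative D) (at z)"
      unfolding u_def[abs_def] D_def C_def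
      by (rule DERIV_diff[OF D1(1) DERIV_mult[OF P D2]])
    moreover have "z * D + d * u z = d * (1 - z) powr a - (1 - z) powr a *
        (- (1 + a) * z * C + z * (1 - z) * D2 + d * (1 - z) * C)"
      using D1(2) by (simp add: D_def u_def eq flip: C_def) (simp add: algebra_simps)
    \<comment> \<open>The differential equation for \<open>C\<close> replaces \<open>D2\<close>,
      after which all terms in \<open>C\<close> cancel.\<close>
    moreover have "- (1 + a) * z * C + z * (1 - z) * D2 + d * (1 - z) * C = d"
      unfolding ode by (simp add: algebra_simps)
    ultimately show ?thesis by (intro exI[of _ D]) simp
  qed
  \<comment> \<open>\<open>z powr d\<close> is an integrating factor: w' = z^(d-1) (z u' + d u) = 0
    for z > 0. As it may fail to be differentiable at 0, the argument uses the open interval and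
    continuity on the closed one.\<close>
  define w where "w z = z powr d * u z" for z
  have "w x = w 0"
  proof (rule DERIV_isconst2[of 0 x w x])
    show "0 < x" "0 \<le> x" "x \<le> x" using x False by auto
  next
    fix z assume z: "0 < z" "z < x"
    then obtain D where D: "(u has_real_derivative D) (at z)" "z * D + d * u z = 0"
      using u[of z] x by auto
    have "(w has_real_derivative d * z powr (d - 1) * u z + z powr d * D) (at z)"
      unfolding w_def using z by (auto intro!: derivative_eq_intros D(1))
    moreover have "d * z powr (d - 1) * u z + z powr d * D = z powr (d - 1) * (z * D + d * u z)"
      using z by (simp add: powr_diff algebra_simps)
    ultimately show "(w has_real_derivative 0) (at z)" using D(2) by simp
  next
    show "continuous_on {0..x} w"
      unfolding continuous_on_eq_continuous_within
    proof
      fix z assume z: "z \<in> {0..x}"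
      then obtain D where "(u has_real_derivative D) (at z)" using u[of z] x by auto
      then have cu: "isCont u z" by (rule DERIV_isCont)
      show "continuous (at z within {0..x}) w"
      proof (cases "z = 0")
        case False
        then have "isCont w z" unfolding w_def using cu by (auto intro!: continuous_intros)
        then show ?thesis by (rule continuous_at_imp_continuous_at_within)
      next
        \<comment> \<open>Since \<open>0 powr 0\<close> is 0, the factor \<open>z powr d\<close>
          jumps at the origin when d = 0. Continuity of \<open>w\<close> there comes from
          \<open>u 0 = 0\<close> and |w| <= |u|.\<close>
        case True
        have "(u \<longlongrightarrow> 0) (at 0 within {0..x})"
          using continuous_at_imp_continuous_at_within[OF cu, of "{0..x}"] True u0
          by (simp add: continuous_within)
        then have u_lim: "((\<lambda>y. norm (u y)) \<longlongrightarrow> 0) (at 0 within {0..x})"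
          by (rule tendsto_norm_zero)
        have "norm (w y) \<le> norm (u y)" if "0 \<le> y" "y \<le> x" for y
        proof -
          have "y powr d \<le> 1" using that x d by (intro powr_le1) auto
          then show ?thesis by (simp add: w_def abs_mult mult_left_le_one_le)
        qed
        then have "\<forall>\<^sub>F y in at 0 within {0..x}. norm (w y) \<le> norm (u y)"
          by (auto simp: eventually_at_filter)
        then have "(w \<longlongrightarrow> 0) (at 0 within {0..x})"
          using u_lim by (rule Lim_null_comparison)
        then show ?thesis using True u0 by (simp add: continuous_within w_def)
      qed
    qed
  qed
  then have "u x = 0" using False x u0 by (simp add: w_def)
  then show ?thesis by (simp add: u_def)
qed

section \<open>Differentiability in the parameter \<open>a\<close>\<close>

text \<open>The logarithmic derivative is the sum of 1 / (d + a + k) over k < n, and each summand is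
  at most 1 because d >= 1. The induction expresses this by the product rule.\<close>

lemma has_real_derivative_pochhammer_bound:
  fixes d :: real
  assumes d: "d \<ge> 1"
  shows "\<exists>D. \<forall>a\<ge>0. ((\<lambda>a. pochhammer (d + a) n) has_real_derivative D a) (at a) \<and>
    0 \<le> D a \<and> D a \<le> real n * pochhammer (d + a) n"
proof (induction n)
  case 0
  show ?case by (intro exI[of _ "\<lambda>_. 0"]) simp
next
  case (Suc n)
  then obtain D where D: "\<And>a. a \<ge> 0 \<Longrightarrow>
    ((\<lambda>a. pochhammer (d + a) n) has_real_derivative D a) (at a) \<and>
    0 \<le> D a \<and> D a \<le> real n * pochhammer (d + a) n" by blast
  let ?D = "\<lambda>a. D a * (d + a + real n) + pochhammer (d + a) n"
  have "((\<lambda>a. pochhammer (d + a) (Suc n)) has_real_derivative ?D a) (at a) \<and>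
    0 \<le> ?D a \<and> ?D a \<le> real (Suc n) * pochhammer (d + a) (Suc n)" if a: "a \<ge> 0" for a
  proof (intro conjI)
    have pos: "pochhammer (d + a) n > 0" using d a by (intro pochhammer_pos) simp
    show "((\<lambda>a. pochhammer (d + a) (Suc n)) has_real_derivative ?D a) (at a)"
      unfolding pochhammer_Suc
      by (rule derivative_eq_intros refl conjunct1[OF D[OF a]])+ simp
    show "0 \<le> ?D a" using D[OF a] d a pos by auto
    have "D a * (d + a + real n) \<le> real n * pochhammer (d + a) n * (d + a + real n)"
      using D[OF a] d a by (intro mult_right_mono) auto
    moreover have "pochhammer (d + a) n \<le> pochhammer (d + a) n * (d + a + real n)"
      using pos d a by simp
    ultimately show "?D a \<le> real (Suc n) * pochhammer (d + a) (Suc n)"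
      by (simp add: pochhammer_Suc algebra_simps)
  qed
  then show ?case by (intro exI[of _ ?D]) simp
qed

text \<open>On [0, a + 1] the termwise derivatives are dominated by
  \<open>real n * poch_ratio (a + 1) d n * x ^ n\<close>, as Pochhammer symbols increase with a
  positive argument. This majorant is summable, so the M-test permits termwise
  differentiation.\<close>

lemma poch_ratio_series_differentiable:
  assumes d: "d \<ge> 1" and a: "a \<ge> 0" and x: "0 \<le> x" "x < 1"
  obtains D where
    "((\<lambda>a. \<Sum>n. poch_ratio a d n * x ^ n) has_real_derivative D) (at a within {0..})"
proof -
  obtain P where P: "\<And>n a. a \<ge> 0 \<Longrightarrow>
    ((\<lambda>a. pochhammer (d + a) n) has_real_derivative P n a) (at a) \<and>
    0 \<le> P n a \<and> P n a \<le> real n * pochhammer (d + a) n"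
  proof -
    have "\<forall>n. \<exists>D. \<forall>a\<ge>0. ((\<lambda>a. pochhammer (d + a) n) has_real_derivative D a) (at a) \<and>
      0 \<le> D a \<and> D a \<le> real n * pochhammer (d + a) n"
      using has_real_derivative_pochhammer_bound[OF d] by simp
    from choice[OF this] show ?thesis using that by auto
  qed
  have pos: "pochhammer d n > 0" for n using d by (intro pochhammer_pos) simp
  have sm: "summable (\<lambda>n. poch_ratio a' d n * z ^ n)" if "a' \<ge> 0" "norm z < 1" for a' z
    using d that by (intro summable_poch_ratio) auto
  let ?f = "\<lambda>n a. poch_ratio a d n * x ^ n"
  let ?f' = "\<lambda>n a. P n a / pochhammer d n * x ^ n"
  let ?S = "{0..a + 1}"
  have "summable (\<lambda>n. real n * poch_ratio (a + 1) d n * x ^ n)"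
    using power_series_deriv_sums[OF sm, of "a + 1" x] a x by (auto simp: sums_iff)
  moreover have "norm (?f' n b) \<le> real n * poch_ratio (a + 1) d n * x ^ n" if "b \<in> ?S" for n b
  proof -
    have b: "b \<ge> 0" "b \<le> a + 1" using that by auto
    have "pochhammer (d + b) n \<le> pochhammer (d + (a + 1)) n"
      using d b by (auto simp: pochhammer_prod intro!: prod_mono)
    then have "P n b \<le> real n * pochhammer (d + (a + 1)) n"
      using P[OF b(1), of n] mult_left_mono[of "pochhammer (d + b) n" _ "real n"]
      by force
    then show ?thesis
      using P[OF b(1), of n] pos[of n] x
      by (simp add: poch_ratio_def abs_mult mult_right_mono divide_right_mono)
  qed
  ultimately have "uniformly_convergent_on ?S (\<lambda>n b. \<Sum>i<n. ?f' i b)"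
    by (intro Weierstrass_m_test') auto
  then obtain g' where g': "uniform_limit ?S (\<lambda>n b. \<Sum>i<n. ?f' i b) g' sequentially"
    by (auto simp: uniformly_convergent_on_def)
  have der: "(?f n has_real_derivative ?f' n b) (at b within ?S)" if "b \<in> ?S" for n b
    unfolding poch_ratio_def using that P[of b n]
    by (intro DERIV_cmult_right DERIV_cdivide) (auto intro: has_field_derivative_at_within)
  have "\<exists>g. \<forall>b\<in>?S. (\<lambda>n. ?f n b) sums g b \<and> (g has_real_derivative g' b) (at b within ?S)"
    by (rule has_field_derivative_series[of ?S ?f ?f' g' a]) (use der g' sm[of a x] a x in auto)
  then obtain g where g: "\<And>b. b \<in> ?S \<Longrightarrow> (\<lambda>n. ?f n b) sums g b \<and>
      (g has_real_derivative g' b) (at b within ?S)" by blast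
  have "((\<lambda>b. \<Sum>n. ?f n b) has_real_derivative g' a) (at a within ?S)"
    by (rule has_field_derivative_transform_within[of g _ _ _ 1]) (use a g in \<open>auto simp: sums_iff\<close>)
  moreover have "at a within {0..} = at a within ?S"
    by (rule at_within_nhd[where S = "{..<a + 1}"]) auto
  ultimately show ?thesis using that by simp
qed

section \<open>Stationary laws: balance equations and cut equations\<close>

lemma pmf_sums_1: "pmf \<pi> sums 1" for \<pi> :: "nat pmf"
proof -
  have "(\<Sum>n. ennreal (pmf \<pi> n)) = 1"
    using nn_integral_pmf[of UNIV \<pi>] by (simp add: nn_integral_count_space_nat)
  then have "(\<lambda>n. ennreal (pmf \<pi> n)) sums ennreal 1"
    by (metis ennreal_1 summableI summable_sums)
  then show ?thesis by (subst (asm) sums_ennreal) auto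
qed

text \<open>With s = 1 - q, a batch has at least m shares with probability s^(m-1). Thus \<eta>
  times this sum is the flow from \<open>{..<n}\<close> to \<open>{n..}\<close> in units of
  \<theta>.\<close>

definition batch_sum :: "real \<Rightarrow> (nat \<Rightarrow> real) \<Rightarrow> nat \<Rightarrow> real" where
  "batch_sum s f n = (\<Sum>k<n. f k * s ^ (n - k - 1))"

lemma batch_sum_0 [simp]: "batch_sum s f 0 = 0"
  by (simp add: batch_sum_def)

lemma batch_sum_Suc: "batch_sum s f (Suc n) = s * batch_sum s f n + f n"
proof -
  have "(\<Sum>k<n. f k * s ^ (n - k)) = s * (\<Sum>k<n. f k * s ^ (n - k - 1))"
    unfolding sum_distrib_left
  proof (rule sum.cong)
    fix k assume "k \<in> {..<n}"
    then have "n - k = Suc (n - k - 1)" by auto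
    then show "f k * s ^ (n - k) = s * (f k * s ^ (n - k - 1))"
      by simp
  qed simp
  then show ?thesis by (simp add: batch_sum_def)
qed

text \<open>Indexed by batch size, the upward jumps form a geometric series of total \<Lambda>; the
  only downward target is j - 1, absent for j = 0.\<close>

lemma infsum_book_size_rate:
  assumes q: "0 < q" "q < 1"
  shows "(\<Sum>\<^sub>\<infinity>k\<in>-{j}. book_size_rate \<Lambda> q \<mu> \<theta> j k) =
    \<Lambda> + (if j = 0 then 0 else \<mu> + real j * \<theta>)"
proof (rule infsumI)
  let ?r = "book_size_rate \<Lambda> q \<mu> \<theta> j"
  have "(\<lambda>n. (1 - q) ^ n) sums (1 / (1 - (1 - q)))"
    using q by (intro geometric_sums) auto
  from sums_mult[OF this, of q] have "(\<lambda>n. q * (1 - q) ^ n) sums 1"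
    using q by simp
  then have "((\<lambda>n. q * (1 - q) ^ n) has_sum 1) UNIV"
    using q by (intro sums_nonneg_imp_has_sum) auto
  from has_sum_cmult_right[OF this, of \<Lambda>]
  have "((\<lambda>n. ?r (Suc j + n)) has_sum \<Lambda>) UNIV"
    by (simp add: book_size_rate_def mult_ac)
  then have "(?r has_sum \<Lambda>) ((\<lambda>n. Suc j + n) ` UNIV)"
    by (subst has_sum_reindex) (auto simp: o_def inj_on_def)
  also have "(\<lambda>n. Suc j + n) ` UNIV = {j<..}"
    by (auto simp: image_iff less_iff_Suc_add)
  finally have up: "(?r has_sum \<Lambda>) {j<..}" .
  have "(?r has_sum (if j = 0 then 0 else \<mu> + real j * \<theta>)) {..<j}"
    by (rule has_sum_finite_neutralI[where B = "if j = 0 then {} else {j - 1}"])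
       (auto simp: book_size_rate_def)
  from has_sum_Un_disjoint[OF up this]
  have "(?r has_sum \<Lambda> + (if j = 0 then 0 else \<mu> + real j * \<theta>)) ({j<..} \<union> {..<j})"
    by force
  also have "{j<..} \<union> {..<j} = - {j}" by auto
  finally show "(?r has_sum \<Lambda> + (if j = 0 then 0 else \<mu> + real j * \<theta>)) (- {j})" .
qed

text \<open>The balance equations are equivalent to the cut equations: the flow from
  \<open>{..<n}\<close> to \<open>{n..}\<close> equals the flow back.\<close>

lemma stationary_distribution_book_size_iff:
  assumes q: "0 < q" "q < 1" and \<theta>: "\<theta> > 0"
  shows "stationary_distribution (book_size_rate (\<theta> * \<eta>) q (\<theta> * \<delta>) \<theta>) \<pi> \<longleftrightarrow>
    (\<forall>n. (\<delta> + real (Suc n)) * pmf \<pi> (Suc n) = \<eta> * batch_sum (1 - q) (pmf \<pi>) (Suc n))"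
proof -
  let ?r = "book_size_rate (\<theta> * \<eta>) q (\<theta> * \<delta>) \<theta>"
  let ?S = "batch_sum (1 - q) (pmf \<pi>)"
  \<comment> \<open>This is the downward flow out of \<open>n\<close> in units of \<theta>. The
    value 0 at n = 0 (an empty book has no departures) makes the cut equation trivial there and
    starts the induction.\<close>
  define w where "w n = (if n = 0 then 0 else (\<delta> + real n) * pmf \<pi> n)" for n
  have inflow: "((\<lambda>i. pmf \<pi> i * ?r i j) has_sum \<theta> * (\<eta> * q * ?S j + w (Suc j))) (-{j})" for j
  proof (rule has_sum_finite_neutralI[where B = "insert (Suc j) {..<j}"])
    have "(\<Sum>i<j. pmf \<pi> i * ?r i j) = \<theta> * \<eta> * q * ?S j"
      by (simp add: batch_sum_def book_size_rate_def sum_distrib_left mult_ac)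
    then show "\<theta> * (\<eta> * q * ?S j + w (Suc j)) = (\<Sum>i\<in>insert (Suc j) {..<j}. pmf \<pi> i * ?r i j)"
      by (simp add: w_def book_size_rate_def algebra_simps)
  qed (auto simp: book_size_rate_def)
  have inflow_iff: "((\<lambda>i. pmf \<pi> i * ?r i j) has_sum X) (-{j}) \<longleftrightarrow>
      \<theta> * (\<eta> * q * ?S j + w (Suc j)) = X" for j X
    using inflow[of j] by (auto dest: has_sum_unique)
  have outflow: "pmf \<pi> j * (\<Sum>\<^sub>\<infinity>k\<in>-{j}. ?r j k) = \<theta> * (\<eta> * pmf \<pi> j + w j)" for j
    by (simp add: infsum_book_size_rate[OF q] w_def algebra_simps)
  have "stationary_distribution ?r \<pi> \<longleftrightarrow>
      (\<forall>j. \<theta> * (\<eta> * q * ?S j + w (Suc j)) = \<theta> * (\<eta> * pmf \<pi> j + w j))"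
    unfolding stationary_distribution_def outflow inflow_iff ..
  also have "\<dots> \<longleftrightarrow> (\<forall>j. w (Suc j) = w j + \<eta> * (pmf \<pi> j - q * ?S j))"
    unfolding mult_cancel_left using \<theta> by (simp add: algebra_simps eq_diff_eq)
  \<comment> \<open>As \<open>?S (Suc j) - ?S j = pmf \<pi> j - q * ?S j\<close>, balance says that
    \<open>w\<close> and \<open>\<eta> * ?S\<close> have equal increments; both start at 0.\<close>
  also have "\<dots> \<longleftrightarrow> (\<forall>n. w n = \<eta> * ?S n)"
  proof
    assume *: "\<forall>j. w (Suc j) = w j + \<eta> * (pmf \<pi> j - q * ?S j)"
    show "\<forall>n. w n = \<eta> * ?S n"
    proof
      fix n show "w n = \<eta> * ?S n"
        by (induction n) (simp_all add: * batch_sum_Suc algebra_simps, simp add: w_def)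
    qed
  qed (simp add: batch_sum_Suc algebra_simps)
  also have "\<dots> \<longleftrightarrow> (\<forall>n. w (Suc n) = \<eta> * ?S (Suc n))"
      proof
    assume *: "\<forall>n. w (Suc n) = \<eta> * ?S (Suc n)"
    show "\<forall>n. w n = \<eta> * ?S n"
    proof
      fix n show "w n = \<eta> * ?S n" using * by (cases n) (simp_all add: w_def)
    qed
  qed simp
  finally show ?thesis by (simp add: w_def)
qed

section \<open>Explicit stationary weights, their mass and mean\<close>

text \<open>Inserting the cut equation into the recursion of \<open>batch_sum\<close> gives S_(n+2)
  = s S_(n+1) (1 + \<delta> + n + \<eta>/s) / (1 + \<delta> + n). With S_1 = 1 this solves to
  \<open>s ^ n * poch_ratio (\<eta> / s) (1 + \<delta>) n\<close> for S_(n+1), and the weight is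
  read off the cut equation.\<close>

fun book_weight :: "real \<Rightarrow> real \<Rightarrow> real \<Rightarrow> nat \<Rightarrow> real" where
  "book_weight \<delta> \<eta> s 0 = 1"
| "book_weight \<delta> \<eta> s (Suc n) =
    \<eta> * s ^ n * poch_ratio (\<eta> / s) (1 + \<delta>) n / (\<delta> + real (Suc n))"

definition book_series :: "real \<Rightarrow> real \<Rightarrow> real \<Rightarrow> real" where
  "book_series \<delta> \<eta> s = (\<Sum>n. poch_ratio (\<eta> / s) (1 + \<delta>) n * s ^ n)"

context
  fixes \<delta> \<eta> s :: real
  assumes \<delta>: "\<delta> \<ge> 0" and \<eta>: "\<eta> \<ge> 0" and s: "0 < s" "s < 1"
begin

lemma book_weight_nonneg: "book_weight \<delta> \<eta> s n \<ge> 0"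
  using \<delta> \<eta> s poch_ratio_pos[of "1 + \<delta>" "\<eta> / s"] by (cases n) (auto simp: less_imp_le)

lemma book_series_sums:
  "(\<lambda>n. poch_ratio (\<eta> / s) (1 + \<delta>) n * s ^ n) sums book_series \<delta> \<eta> s"
  unfolding book_series_def using \<delta> \<eta> s by (intro summable_sums summable_poch_ratio) auto

lemma book_series_pos: "book_series \<delta> \<eta> s > 0"
  unfolding book_series_def
  using \<delta> \<eta> s by (intro suminf_pos summable_poch_ratio mult_pos_pos poch_ratio_pos) auto

text \<open>This is the recursion of the batch sums solved for the weight. It serves both the
  induction for \<open>batch_sum\<close> and the total mass.\<close>

lemma book_weight_Suc_eq:
  "book_weight \<delta> \<eta> s (Suc n) = poch_ratio (\<eta> / s) (1 + \<delta>) (Suc n) * s ^ Suc n -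
    s * (poch_ratio (\<eta> / s) (1 + \<delta>) n * s ^ n)"
proof -
  have "1 + \<delta> + real n \<noteq> 0" using \<delta> by linarith
  moreover have "\<delta> + real (Suc n) = 1 + \<delta> + real n" by simp
  ultimately show ?thesis
    using \<delta> s unfolding book_weight.simps by (simp add: poch_ratio_Suc divide_simps) (simp add: algebra_simps)
qed

lemma batch_sum_book_weight:
  "batch_sum s (book_weight \<delta> \<eta> s) (Suc n) = s ^ n * poch_ratio (\<eta> / s) (1 + \<delta>) n"
proof (induction n)
  case 0
  show ?case by (simp add: batch_sum_Suc)
next
  case (Suc n)
  show ?case
    unfolding batch_sum_Suc[of _ _ "Suc n"] Suc.IH book_weight_Suc_eq by (simp add: mult_ac)
qed

lemma book_weight_cut:
  "(\<delta> + real (Suc n)) * book_weight \<delta> \<eta> s (Suc n) = \<eta> * batch_sum s (book_weight \<delta> \<eta> s) (Suc n)"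
proof -
  have "\<delta> + real (Suc n) \<noteq> 0" using \<delta> by linarith
  then show ?thesis unfolding batch_sum_book_weight book_weight.simps by simp
qed

text \<open>The cut equation at n + 1 determines \<open>f (Suc n)\<close> from the values
  \<open>f k\<close> with k <= n, linearly, so \<open>f 0\<close> fixes everything.\<close>

lemma cut_imp_book_weight:
  assumes cut: "\<And>n. (\<delta> + real (Suc n)) * f (Suc n) = \<eta> * batch_sum s f (Suc n)"
  shows "f n = f 0 * book_weight \<delta> \<eta> s n"
proof (induction n rule: less_induct)
  case (less n)
  show ?case
  proof (cases n)
    case (Suc m)
    have "batch_sum s f (Suc m) = f 0 * batch_sum s (book_weight \<delta> \<eta> s) (Suc m)"
      unfolding batch_sum_def sum_distrib_left
    proof (rule sum.cong)
      fix k assume "k \<in> {..<Suc m}"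
      then have "f k = f 0 * book_weight \<delta> \<eta> s k" using Suc by (intro less) simp
      then show "f k * s ^ (Suc m - k - 1) = f 0 * (book_weight \<delta> \<eta> s k * s ^ (Suc m - k - 1))"
        by simp
    qed simp
    then have "(\<delta> + real (Suc m)) * f (Suc m) =
        (\<delta> + real (Suc m)) * (f 0 * book_weight \<delta> \<eta> s (Suc m))"
      using cut[of m] book_weight_cut[of m] by (simp del: book_weight.simps)
    moreover have "\<delta> + real (Suc m) \<noteq> 0" using \<delta> by linarith
    ultimately show ?thesis using Suc by (simp del: book_weight.simps)
  qed simp
qed

text \<open>Summing \<open>book_weight_Suc_eq\<close> gives (C - 1) - s C for the positive states;
  state 0 adds the missing 1.\<close>

lemma book_weight_sums: "book_weight \<delta> \<eta> s sums ((1 - s) * book_series \<delta> \<eta> s)"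
proof -
  have "(\<lambda>n. poch_ratio (\<eta> / s) (1 + \<delta>) (Suc n) * s ^ Suc n) sums (book_series \<delta> \<eta> s - 1)"
    using book_series_sums by (subst sums_Suc_iff) simp
  from sums_diff[OF this sums_mult[OF book_series_sums, of s]]
  have "(\<lambda>n. book_weight \<delta> \<eta> s (Suc n)) sums (book_series \<delta> \<eta> s - 1 - s * book_series \<delta> \<eta> s)"
    unfolding book_weight_Suc_eq .
  then show ?thesis by (subst (asm) sums_Suc_iff) (simp add: algebra_simps)
qed

text \<open>Write n w_n = (\<delta> + n) w_n - \<delta> w_n: by the cut equation the first part is
  \<eta> times a term of C, so only C and the mass of the positive states enter.\<close>

lemma book_weight_mean_sums:
  "(\<lambda>n. real n * book_weight \<delta> \<eta> s n) sums
    (\<eta> * book_series \<delta> \<eta> s - \<delta> * ((1 - s) * book_series \<delta> \<eta> s - 1))"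
proof -
  have "(\<lambda>n. book_weight \<delta> \<eta> s (Suc n)) sums ((1 - s) * book_series \<delta> \<eta> s - 1)"
    using book_weight_sums by (subst sums_Suc_iff) simp
  from sums_diff[OF sums_mult[OF book_series_sums, of \<eta>] sums_mult[OF this, of \<delta>]]
  have "(\<lambda>n. \<eta> * (poch_ratio (\<eta> / s) (1 + \<delta>) n * s ^ n) - \<delta> * book_weight \<delta> \<eta> s (Suc n)) sums
    (\<eta> * book_series \<delta> \<eta> s - \<delta> * ((1 - s) * book_series \<delta> \<eta> s - 1))" .
  moreover have "\<eta> * (poch_ratio (\<eta> / s) (1 + \<delta>) n * s ^ n) - \<delta> * book_weight \<delta> \<eta> s (Suc n) =
      real (Suc n) * book_weight \<delta> \<eta> s (Suc n)" for n
    using book_weight_cut[of n] unfolding batch_sum_book_weight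
    by (simp del: book_weight.simps add: algebra_simps)
  ultimately show ?thesis
    using sums_Suc_iff[of "\<lambda>n. real n * book_weight \<delta> \<eta> s n"] by (simp del: book_weight.simps)
qed

text \<open>Every solution is a multiple of \<open>book_weight\<close>, and total mass 1 fixes the
  multiple. The explicit formula is shown first because uniqueness rests on it.\<close>

lemma ex1_pmf_cut:
  "\<exists>!\<pi>. \<forall>n. (\<delta> + real (Suc n)) * pmf \<pi> (Suc n) = \<eta> * batch_sum s (pmf \<pi>) (Suc n)"
  and pmf_cut_eq: "(\<And>n. (\<delta> + real (Suc n)) * pmf \<pi> (Suc n) = \<eta> * batch_sum s (pmf \<pi>) (Suc n)) \<Longrightarrow>
    pmf \<pi> m = book_weight \<delta> \<eta> s m / ((1 - s) * book_series \<delta> \<eta> s)"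
proof -
  let ?Z = "(1 - s) * book_series \<delta> \<eta> s"
  have Z: "?Z > 0" using book_series_pos s by simp
  show eq: "pmf \<pi> m = book_weight \<delta> \<eta> s m / ?Z"
    if "\<And>n. (\<delta> + real (Suc n)) * pmf \<pi> (Suc n) = \<eta> * batch_sum s (pmf \<pi>) (Suc n)" for \<pi> m
  proof -
    have f: "pmf \<pi> n = pmf \<pi> 0 * book_weight \<delta> \<eta> s n" for n
      using that by (rule cut_imp_book_weight)
    have "pmf \<pi> sums (pmf \<pi> 0 * ?Z)"
      unfolding sums_cong[of "pmf \<pi>", OF f] by (intro sums_mult book_weight_sums)
    with pmf_sums_1[of \<pi>] have "pmf \<pi> 0 * ?Z = 1" by (rule sums_unique2[symmetric])
    then have "pmf \<pi> 0 = 1 / ?Z" by (metis eq_divide_eq mult_zero_right zero_neq_one)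
    then show ?thesis unfolding f[of m] by simp
  qed
  \<comment> \<open>Existence: the normalised weights form a pmf, and the cut equations, being
    linear and homogeneous, survive the scaling.\<close>
  define \<pi> where "\<pi> = embed_pmf (\<lambda>n. book_weight \<delta> \<eta> s n / ?Z)"
  have "(\<lambda>n. book_weight \<delta> \<eta> s n / ?Z) sums 1"
    using sums_divide[OF book_weight_sums, of ?Z] Z by (metis divide_self less_irrefl)
  then have "(\<integral>\<^sup>+ n. ennreal (book_weight \<delta> \<eta> s n / ?Z) \<partial>count_space UNIV) = 1"
    unfolding nn_integral_count_space_nat using Z book_weight_nonneg
    by (subst suminf_ennreal_eq) auto
  then have \<pi>: "pmf \<pi> n = book_weight \<delta> \<eta> s n / ?Z" for n
    unfolding \<pi>_def using Z book_weight_nonneg by (subst pmf_embed_pmf) auto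
  have "(\<delta> + real (Suc n)) * pmf \<pi> (Suc n) = \<eta> * batch_sum s (pmf \<pi>) (Suc n)" for n
  proof -
    have "batch_sum s (pmf \<pi>) (Suc n) = batch_sum s (book_weight \<delta> \<eta> s) (Suc n) / ?Z"
      unfolding batch_sum_def \<pi> sum_divide_distrib times_divide_eq_left ..
    then show ?thesis using book_weight_cut[of n] by (simp del: book_weight.simps add: \<pi>)
  qed
  then show "\<exists>!\<pi>. \<forall>n. (\<delta> + real (Suc n)) * pmf \<pi> (Suc n) = \<eta> * batch_sum s (pmf \<pi>) (Suc n)"
  proof (intro ex1I allI pmf_eqI)
    fix \<rho> :: "nat pmf" and m
    assume "\<forall>n. (\<delta> + real (Suc n)) * pmf \<rho> (Suc n) = \<eta> * batch_sum s (pmf \<rho>) (Suc n)"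
    then show "pmf \<rho> m = pmf \<pi> m" unfolding \<pi> by (intro eq) blast
  qed
qed

text \<open>The first moment is divided by the mass. Integrability is recorded separately because
  the integral of a non-integrable function is 0 by convention.\<close>

lemma pmf_cut_mean:
  assumes cut: "\<And>n. (\<delta> + real (Suc n)) * pmf \<pi> (Suc n) = \<eta> * batch_sum s (pmf \<pi>) (Suc n)"
  shows "integrable (measure_pmf \<pi>) real"
    and "measure_pmf.expectation \<pi> real =
      \<eta> / (1 - s) - \<delta> + \<delta> / ((1 - s) * book_series \<delta> \<eta> s)"
proof -
  let ?Z = "(1 - s) * book_series \<delta> \<eta> s"
  have Z: "?Z > 0" using book_series_pos s by simp
  have sums: "(\<lambda>n. pmf \<pi> n * real n) sums ((\<eta> * book_series \<delta> \<eta> s - \<delta> * (?Z - 1)) / ?Z)"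
    using sums_divide[OF book_weight_mean_sums, of ?Z] by (simp add: pmf_cut_eq[OF cut] mult_ac)
  then have int: "integrable (count_space UNIV) (\<lambda>n. pmf \<pi> n * real n)"
    by (simp add: integrable_count_space_nat_iff sums_iff)
  then show "integrable (measure_pmf \<pi>) real"
    by (simp add: measure_pmf_eq_density integrable_density)
  have "measure_pmf.expectation \<pi> real = (\<Sum>n. pmf \<pi> n * real n)"
    using integral_count_space_nat[OF int] by (simp add: measure_pmf_eq_density integral_density)
  also have "\<dots> = (\<eta> * book_series \<delta> \<eta> s - \<delta> * (?Z - 1)) / ?Z"
    using sums by (simp add: sums_iff)
  also have "\<dots> = \<eta> / (1 - s) - \<delta> + \<delta> / ?Z"
    using book_series_pos s by (simp add: divide_simps) (simp add: algebra_simps)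
  finally show "measure_pmf.expectation \<pi> real = \<eta> / (1 - s) - \<delta> + \<delta> / ?Z" .
qed

text \<open>Euler's transformation at x = s, with one factor \<open>1 - s\<close> split off so that
  the total mass appears. The remaining power cancels against the numerator of
  \<open>F\<close>.\<close>

lemma hypergeo_book_series:
  "hypergeo_2F1 \<delta> (- \<eta> / s) (1 + \<delta>) s = (1 - s) powr (\<eta> / s) * ((1 - s) * book_series \<delta> \<eta> s)"
  using hypergeo_Euler[of \<delta> "\<eta> / s" s] \<delta> \<eta> s by (simp add: book_series_def powr_add)

end

section \<open>Dependence on the price\<close>

theorem proposition4:
  fixes \<alpha> \<mu> \<theta> q \<delta> :: real
    and h_lam h H B b F :: "real \<Rightarrow> real"
  assumes "0 \<le> \<alpha>"
    and "\<And>p. 0 \<le> h_lam p"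
    and "\<And>p. p < 0 \<Longrightarrow> h_lam p = 0"
    and "\<And>p. h_lam integrable_on {0..p}"
    and "0 \<le> \<mu>" and "0 < \<theta>" and "0 < q" and "q < 1"
    and "\<delta> = \<mu> / \<theta>"
    and "h = (\<lambda>p. \<alpha> * h_lam p / \<theta>)"
    and "H = (\<lambda>p. integral {0..p} h)"
    and "B = average_cumulative_shape \<alpha> h_lam q \<mu> \<theta>"
    and "b = price_deriv B"
    and "F = (\<lambda>p. \<delta> * q powr (H p / (1 - q)) /
                   hypergeo_2F1 \<delta> (- H p / (1 - q)) (1 + \<delta>) (1 - q))"
  shows "(\<forall>p\<ge>0. (\<exists>!\<pi>. stationary_distribution (L_rate \<alpha> h_lam q \<mu> \<theta> p) \<pi>) \<and>
                 integrable (measure_pmf (L_law \<alpha> h_lam q \<mu> \<theta> p)) real) \<and>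
         (\<forall>p\<ge>0. (H has_real_derivative h p) (at p within {0..}) \<longrightarrow>
            B differentiable (at p within {0..}) \<and>
            F differentiable (at p within {0..}) \<and>
            b p = h p / q + price_deriv F p)"
proof -
  note \<delta>_def = \<open>\<delta> = \<mu> / \<theta>\<close> and h_def = \<open>h = _\<close> and H_def = \<open>H = _\<close>
    and B_def = \<open>B = _\<close> and b_def = \<open>b = _\<close> and F_def = \<open>F = _\<close>
  \<comment> \<open>\<open>Z p\<close> is the total mass of the weights for
    \<open>\<eta> = H p\<close>; its reciprocal is the stationary probability of an empty
    book.\<close>
  define Z where "Z p = q * book_series \<delta> (H p) (1 - q)" for p
  have \<delta>: "\<delta> \<ge> 0" and \<mu>: "\<mu> = \<theta> * \<delta>"
    using assms(5,6) by (simp_all add: \<delta>_def)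
  have q: "0 < q" "q < 1" "0 < 1 - q" "1 - q < 1" using assms(7,8) by simp_all
  have H_eq: "H p = \<alpha> / \<theta> * integral {0..p} h_lam" for p
    using integral_mult_right[of "{0..p}" "\<alpha> / \<theta>" h_lam] by (simp add: H_def h_def)
  have "integral {0..p} h_lam \<ge> 0" for p
    using assms(4,2) by (rule Henstock_Kurzweil_Integration.integral_nonneg)
  then have H_nonneg: "H p \<ge> 0" for p
    using assms(1,6) by (simp add: H_eq)
  have "limit_order_rate \<alpha> h_lam p = \<theta> * H p" for p
    using assms(6) by (simp add: limit_order_rate_def H_eq)
  then have stationary: "stationary_distribution (L_rate \<alpha> h_lam q \<mu> \<theta> p) \<pi> \<longleftrightarrow>
      (\<forall>n. (\<delta> + real (Suc n)) * pmf \<pi> (Suc n) = H p * batch_sum (1 - q) (pmf \<pi>) (Suc n))" for p \<pi>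
    unfolding L_rate_def \<mu> using q by (simp only: stationary_distribution_book_size_iff \<open>0 < \<theta>\<close>)
  have ex1: "\<exists>!\<pi>. stationary_distribution (L_rate \<alpha> h_lam q \<mu> \<theta> p) \<pi>" for p
    unfolding stationary using \<delta> H_nonneg q(3,4) by (rule ex1_pmf_cut)
  have "stationary_distribution (L_rate \<alpha> h_lam q \<mu> \<theta> p) (L_law \<alpha> h_lam q \<mu> \<theta> p)" for p
    unfolding L_law_def using ex1 by (rule theI')
  then have cut: "(\<delta> + real (Suc n)) * pmf (L_law \<alpha> h_lam q \<mu> \<theta> p) (Suc n) =
      H p * batch_sum (1 - q) (pmf (L_law \<alpha> h_lam q \<mu> \<theta> p)) (Suc n)" for p n
    unfolding stationary by blast
  have int: "integrable (measure_pmf (L_law \<alpha> h_lam q \<mu> \<theta> p)) real" for p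
    by (rule pmf_cut_mean(1)[OF \<delta> H_nonneg q(3,4) cut])
  have B: "B p = H p / q - \<delta> + \<delta> / Z p" for p
    using pmf_cut_mean(2)[OF \<delta> H_nonneg q(3,4) cut]
    by (simp add: B_def average_cumulative_shape_def Z_def)
  have F: "F p = \<delta> / Z p" for p
    using hypergeo_book_series[OF \<delta> H_nonneg q(3,4), of p] q(1)
    by (simp add: F_def Z_def)
  have Z_pos: "Z p > 0" for p
    using book_series_pos[OF \<delta> H_nonneg q(3,4)] q(1) by (simp add: Z_def)
  have "B differentiable (at p within {0..}) \<and> F differentiable (at p within {0..}) \<and>
      b p = h p / q + price_deriv F p"
    if p: "p \<ge> 0" and dH: "(H has_real_derivative h p) (at p within {0..})" for p
  proof -
    let ?C = "\<lambda>a. \<Sum>n. poch_ratio a (1 + \<delta>) n * (1 - q) ^ n"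
    obtain D where "(?C has_real_derivative D) (at (H p / (1 - q)) within {0..})"
      using poch_ratio_series_differentiable[of "1 + \<delta>" "H p / (1 - q)" "1 - q"] \<delta> H_nonneg q
      by auto
    \<comment> \<open>The chain rule within a set asks for the outer derivative along the image of
      the price axis, which lies in \<open>{0..}\<close> as \<open>H\<close> is
      non-negative.\<close>
    then have "(?C has_real_derivative D) (at (H p / (1 - q)) within (\<lambda>p. H p / (1 - q)) ` {0..})"
      by (rule has_field_derivative_subset) (use H_nonneg q in auto)
    then have "(?C \<circ> (\<lambda>p. H p / (1 - q)) has_real_derivative D * (h p / (1 - q))) (at p within {0..})"
      using DERIV_cdivide[OF dH] by (rule DERIV_image_chain)
    from DERIV_cmult[OF this, of q]
    have dZ: "(Z has_real_derivative q * (D * (h p / (1 - q)))) (at p within {0..})"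
      by (simp add: o_def Z_def[abs_def] book_series_def)
    obtain F' where dF: "(F has_real_derivative F') (at p within {0..})"
      using DERIV_divide[OF DERIV_const dZ] Z_pos[of p] by (auto simp: F[abs_def])
    \<comment> \<open>The facts \<open>B\<close> and \<open>F\<close> give B = H / q - \<delta> + F,
      and the constant drops out.\<close>
    have "((\<lambda>x. H x / q - \<delta> + F x) has_real_derivative h p / q - 0 + F') (at p within {0..})"
      by (intro DERIV_add DERIV_diff DERIV_cdivide DERIV_const dH dF)
    then have dB: "(B has_real_derivative h p / q + F') (at p within {0..})"
      by (simp add: B[abs_def] F[abs_def])
    \<comment> \<open>\<open>vector_derivative\<close> chooses some derivative, so its value is
      determined only where derivatives are unique. Right neighbourhoods of \<open>p\<close> suffice
      for this, also at p = 0.\<close>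
    have nontriv: "at p within {0..} \<noteq> bot"
    proof
      assume bot: "at p within {0..} = bot"
      have "at_right p \<le> at p within {0..}" using p by (intro at_le) auto
      then show False unfolding bot using trivial_limit_at_right_real[of p] by (simp add: bot_unique)
    qed
    have deriv: "price_deriv f p = f'" if "(f has_real_derivative f') (at p within {0..})" for f f'
      unfolding price_deriv_def using that nontriv
      by (intro vector_derivative_within) (simp_all add: has_real_derivative_iff_has_vector_derivative)
    show ?thesis
      using dB dF deriv[OF dB] deriv[OF dF]
      by (auto simp: b_def has_field_derivative_def differentiable_def)
  qed
  with ex1 int show ?thesis by blast
qed

end
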